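(* Let $B\in\{1,\dots,9\}$, let $\tilde p\neq0$ be an integer and $\tilde q$ a positive integer with $\tilde q\geqslant 20\sqrt[3]{|\tilde p|}$. Put $$F_1=B^{2}\tilde q^{6}+2B\tilde q^{4}-2B\tilde p\tilde q^{3}-2\tilde q^{2}-2\tilde p\tilde q+\tilde p^{2}+\frac5B-\frac{20}{B^{2}\tilde q^{2}}.$$ Then the equation $\tilde Q(t)=0$ has at least one real root $t$ with $F_1+\frac{10\tilde p}{B^{2}\tilde q^{3}}<t<F_1$ in the case $\tilde p<0$, respectively with $F_1<t<F_1+\frac{10\tilde p}{B^{2}\tilde q^{3}}$ in the case $\tilde p>0$.
   Context: For numbers $p,q$ let $$Q_{pq}(t)=t^{10}+(2q^{2}+p^{2})(3q^{2}-2p^{2})\,t^{8}+(q^{8}+10p^{2}q^{6}+4p^{4}q^{4}-14p^{6}q^{2}+p^{8})\,t^{6}-p^{2}q^{2}(q^{8}-14p^{2}q^{6}+4p^{4}q^{4}+10p^{6}q^{2}+p^{8})\,t^{4}-p^{6}q^{6}(q^{2}+2p^{2})(3p^{2}-2q^{2})\,t^{2}-q^{10}p^{10}.$$ Given $B$, $\tilde p$, $\tilde q$, define $\tilde Q(t)=Q_{pq}(t)$ with $p=B\tilde q^{3}-\tilde p$ and $q=\tilde q$. *)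

theory Defs
  imports Complex_Main
begin

definition Q_pq :: "real \<Rightarrow> real \<Rightarrow> real \<Rightarrow> real" where
  "Q_pq p q t =
     t^10
     + (2*q^2 + p^2) * (3*q^2 - 2*p^2) * t^8
     + (q^8 + 10*p^2*q^6 + 4*p^4*q^4 - 14*p^6*q^2 + p^8) * t^6
     - p^2*q^2 * (q^8 - 14*p^2*q^6 + 4*p^4*q^4 + 10*p^6*q^2 + p^8) * t^4
     - p^6*q^6 * (q^2 + 2*p^2) * (3*p^2 - 2*q^2) * t^2
     - q^10*p^10"

text \<open>In the names below, \<open>pt\<close> and \<open>qt\<close> stand for $\tilde p$ and $\tilde q$.\<close>

definition Q_tilde :: "real \<Rightarrow> real \<Rightarrow> real \<Rightarrow> real \<Rightarrow> real" where
  "Q_tilde B pt qt t = Q_pq (B*qt^3 - pt) qt t"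

definition F1 :: "real \<Rightarrow> real \<Rightarrow> real \<Rightarrow> real" where
  "F1 B pt qt =
     B^2*qt^6 + 2*B*qt^4 - 2*B*pt*qt^3 - 2*qt^2 - 2*pt*qt + pt^2
     + 5/B - 20/(B^2*qt^2)"

end

theory Submission
  imports Defs
begin

text \<open>
  With \<open>p = B qt^3 - pt\<close> and \<open>q = qt\<close> one has
  \<open>F1 = p^2 + 2pq - 2q^2 + 5/B - 20/(B^2 q^2)\<close>. On the other hand \<open>Q_pq\<close> is homogeneous once
  \<open>t\<close> is given weight 2, and for small \<open>q/p\<close> it has a root with the expansion
  \<open>p^2 + 2pq - 2q^2 + 5q^3/p - 20q^4/p^2 + (307/4) q^5/p^3 + \<dots>\<close>. Truncating after
  \<open>q^4/p^2\<close>, respectively rounding \<open>307/4\<close> up to \<open>80\<close>, gives a sign change of \<open>Q_pq\<close>. Since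
  \<open>q^3/p = 1/(B - u)\<close> with \<open>u = pt/qt^3\<close> and \<open>1/(B - u) = 1/B + u/B^2 + \<dots>\<close>, the enclosed root
  differs from \<open>F1\<close> by about \<open>5u/B^2\<close>, half of the allowed deviation; the error term
  \<open>80 q^5/p^3\<close> is at most \<open>4\<bar>u\<bar>/(B - u)^3\<close> because \<open>q \<ge> 20\<close> and \<open>\<bar>u\<bar> \<ge> 1/q^3\<close>.
\<close>

text \<open>Storing the coefficients in a list makes it possible to pass to their absolute values
  with \<open>map abs\<close>.\<close>

definition horner :: "real list \<Rightarrow> real \<Rightarrow> real" where
  "horner cs s = foldr (\<lambda>a x. a + s * x) cs 0"

text \<open>Termwise triangle inequality; for concrete \<open>cs\<close> and \<open>r\<close> the
  right-hand side is a numeral that \<open>simp\<close> can evaluate.\<close>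

lemma abs_horner_le:
  assumes "\<bar>s\<bar> \<le> r"
  shows "\<bar>horner cs s\<bar> \<le> horner (map abs cs) r"
proof (induction cs)
  case Nil
  then show ?case by (simp add: horner_def)
next
  case (Cons a cs)
  have "\<bar>horner (a # cs) s\<bar> \<le> \<bar>a\<bar> + \<bar>s\<bar> * \<bar>horner cs s\<bar>"
    unfolding horner_def by (simp add: abs_mult[symmetric] abs_triangle_ineq)
  also have "\<dots> \<le> \<bar>a\<bar> + r * horner (map abs cs) r"
    using assms Cons.IH by (intro add_left_mono mult_mono) auto
  finally show ?case by (simp add: horner_def)
qed

text \<open>With \<open>p\<close>, \<open>q\<close> of weight 1 and \<open>t\<close> of weight 2
  every monomial has weight 20, so only the ratio \<open>q / p\<close> matters.\<close>

lemma Q_pq_scale: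
  assumes "p \<noteq> 0"
  shows "Q_pq p q (p^2 * t) = p^20 * Q_pq 1 (q / p) t"
proof -
  define s where "s = q / p"
  have q: "q = s * p" using assms by (simp add: s_def)
  have "Q_pq p (s * p) (p^2 * t) = p^20 * Q_pq 1 s t"
    unfolding Q_pq_def power_one by algebra
  then show ?thesis by (simp add: q assms)
qed

text \<open>At \<open>s = 0\<close> the polynomial is \<open>t^6 * (t^2 - 1)^2\<close>; for small
  \<open>s\<close> its double root 1 splits into roots near \<open>1 + 2*s\<close> and
  \<open>1 - 2*s\<close>, and the slope at the upper one is about \<open>16*s\<close>. Omitting the
  term \<open>307/4 * s^5\<close> therefore gives a value of about
  \<open>-1228 * s^6\<close>.\<close>

lemma Q_pq_truncated_neg:
  fixes s :: real
  assumes "0 < s" "s \<le> 1 / 300"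
  shows "Q_pq 1 s (1 + 2*s - 2*s^2 + 5*s^3 - 20*s^4) < 0"
proof -
  define cs :: "real list" where "cs =
      [-11976, -35460, -32140, 59944, 905572, 2651661, 921092, -649829, -31715350,
       -92891182, 44560724, -106046235, 804210628, 1860215219, -3128461640, 7644772395,
       -23131511450, -6631354075, 54365223000, -197930809000, 580638931250, -775459856250,
       810712487500, 182906815625, -4174874625000, 10622743250000, -21464920000000,
       35575880000000, -46219200000000, 54121600000000, -52480000000000, 39040000000000,
       -25600000000000, 10240000000000]"
  have eq: "Q_pq 1 s (1 + 2*s - 2*s^2 + 5*s^3 - 20*s^4) = s^6 * (-1228 + s * horner cs s)"
    unfolding Q_pq_def power_one horner_def cs_def foldr.simps o_apply id_apply by algebra
  have "\<bar>horner cs s\<bar> \<le> horner (map abs cs) (1 / 300)"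
    using assms by (intro abs_horner_le) auto
  \<comment> \<open>At \<open>s = 1/300\<close> this limits the remainder to 50, far below
    1228.\<close>
  also have "\<dots> \<le> 15000"
    by (simp add: horner_def cs_def)
  finally have "s * \<bar>horner cs s\<bar> \<le> 1 / 300 * 15000"
    using assms by (intro mult_mono) auto
  moreover have "s * horner cs s \<le> s * \<bar>horner cs s\<bar>"
    using assms by (intro mult_left_mono) auto
  ultimately have "-1228 + s * horner cs s < 0" by linarith
  then show ?thesis
    unfolding eq using assms by (intro mult_pos_neg) auto
qed

text \<open>The same slope \<open>16*s\<close> times the excess \<open>(80 - 307/4) * s^5\<close>
  gives the leading term \<open>52 * s^6\<close>.\<close>

lemma Q_pq_truncated_pos:
  fixes s :: real
  assumes "0 < s" "s \<le> 1 / 300"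
  shows "Q_pq 1 s (1 + 2*s - 2*s^2 + 5*s^3 - 20*s^4 + 80*s^5) > 0"
proof -
  define cs :: "real list" where "cs =
      [5944, 53500, 152180, 133544, -155228, 275341, 15476932, 45027931, 17642730,
       -20533742, -274059276, 2311065125, 6118258948, -2756335021, 9954190840,
       -84126846165, 299495256870, 369661425125, -732749584200, 3104478867800,
       -15080044292750, 43813024251750, -36880180916500, 19083716455625, 211311567575000,
       -1390949467050000, 4720392327600000, -10130895575200000, 20568405004800000,
       -31821690752000000, 14275890176000000, 102714586112000000, -428584919040000000,
       1278304993280000000, -3123856670720000000, 6398443520000000000,
       -11443843891200000000, 18856122777600000000, -27472691200000000000,
       34519121920000000000, -37916508160000000000, 36909875200000000000,
       -26843545600000000000, 10737418240000000000]"
  have eq: "Q_pq 1 s (1 + 2*s - 2*s^2 + 5*s^3 - 20*s^4 + 80*s^5) = s^6 * (52 + s * horner cs s)"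
    unfolding Q_pq_def power_one horner_def cs_def foldr.simps o_apply id_apply by algebra
  have "\<bar>horner cs s\<bar> \<le> horner (map abs cs) (1 / 300)"
    using assms by (intro abs_horner_le) auto
  \<comment> \<open>The remainder is at most 30, against 52; the margin is much smaller than for the
    lower truncation.\<close>
  also have "\<dots> \<le> 9000"
    by (simp add: horner_def cs_def)
  finally have "s * \<bar>horner cs s\<bar> \<le> 1 / 300 * 9000"
    using assms by (intro mult_mono) auto
  moreover have "s * horner cs s \<ge> - (s * \<bar>horner cs s\<bar>)"
    using assms mult_left_mono[of "- \<bar>horner cs s\<bar>" "horner cs s" s] by simp
  ultimately have "52 + s * horner cs s > 0" by linarith
  then show ?thesis
    unfolding eq using assms by (intro mult_pos_pos) auto
qed

lemma Q_pq_root: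
  fixes p q :: real
  assumes "0 < q" "300 * q \<le> p"
  obtains t where "Q_pq p q t = 0"
    "p^2 + 2*p*q - 2*q^2 + 5*q^3/p - 20*q^4/p^2 < t"
    "t < p^2 + 2*p*q - 2*q^2 + 5*q^3/p - 20*q^4/p^2 + 80*q^5/p^3"
proof -
  define s where "s = q / p"
  have p: "p > 0" using assms by linarith
  have s: "0 < s" "s \<le> 1 / 300"
    using assms p by (auto simp: s_def field_simps)
  define a where "a = 1 + 2*s - 2*s^2 + 5*s^3 - 20*s^4"
  define b where "b = a + 80*s^5"
  have fa: "Q_pq 1 s a < 0"
    unfolding a_def using s by (rule Q_pq_truncated_neg)
  have fb: "Q_pq 1 s b > 0"
    unfolding a_def b_def using s by (rule Q_pq_truncated_pos)
  have "a \<le> b" using s by (simp add: b_def)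
  moreover have "continuous_on {a..b} (Q_pq 1 s)"
    unfolding Q_pq_def by (intro continuous_intros)
  ultimately obtain y where y: "a \<le> y" "y \<le> b" "Q_pq 1 s y = 0"
    using IVT'[of "Q_pq 1 s" a 0 b] fa fb by auto
  have "y \<noteq> a" "y \<noteq> b" using y(3) fa fb by auto
  then have ab: "a < y" "y < b" using y by auto
  have a': "p^2 * a = p^2 + 2*p*q - 2*q^2 + 5*q^3/p - 20*q^4/p^2"
    unfolding a_def s_def using p by (simp add: field_simps power2_eq_square power3_eq_cube power4_eq_xxxx)
  have b': "p^2 * b = p^2 * a + 80*q^5/p^3"
    unfolding b_def s_def using p by (simp add: field_simps eval_nat_numeral)
  show ?thesis
  proof (rule that[of "p^2 * y"])
    show "Q_pq p q (p^2 * y) = 0"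
      using Q_pq_scale[of p q y] y(3) p by (simp add: s_def)
    show "p^2 + 2*p*q - 2*q^2 + 5*q^3/p - 20*q^4/p^2 < p^2 * y"
      unfolding a'[symmetric] using ab p by simp
    show "p^2 * y < p^2 + 2*p*q - 2*q^2 + 5*q^3/p - 20*q^4/p^2 + 80*q^5/p^3"
      unfolding a'[symmetric] b'[symmetric] using ab p by simp
  qed
qed

text \<open>Here \<open>d\<close> is the exact difference between the lower bound of
  \<open>Q_pq_root\<close> and \<open>F1\<close>. With \<open>r = B - x/q^3\<close> one has
  \<open>1/r - 1/B = (x/q^3) / (B*r)\<close>; pulling out this factor exposes the sign of
  \<open>d\<close>.\<close>

lemma Q_tilde_root:
  fixes B x q :: real
  assumes B: "1 \<le> B" and q: "20 \<le> q" and x: "8000 * \<bar>x\<bar> \<le> q^3"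
  obtains t d where "Q_tilde B x q t = 0"
    "F1 B x q + d < t" "t < F1 B x q + d + 80 / (q^4 * (B - x/q^3)^3)"
    "d = x/q^3 / (B * (B - x/q^3)) * (5 - 20/q^2 * (1/(B - x/q^3) + 1/B))"
proof -
  define r where "r = B - x/q^3"
  define p where "p = B * q^3 - x"
  have "\<bar>x/q^3\<bar> \<le> 1/8000" using q x by (simp add: field_simps)
  then have r: "r \<ge> 7999/8000" using B unfolding r_def by linarith
  have pr: "p = q^3 * r" using q by (simp add: p_def r_def field_simps)
  have "20 * 20 \<le> q * q" using q by (intro mult_mono) auto
  \<comment> \<open>Since \<open>p / q = q^2 * r\<close>, the ratio is at least 399.95, which leaves
    room above the required 300.\<close>
  then have "400 * (7999/8000) \<le> q * q * r" using r q by (intro mult_mono) auto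
  then have "300 * q \<le> (q * q * r) * q" using q by (intro mult_right_mono) auto
  also have "\<dots> = p" by (simp add: pr power3_eq_cube)
  finally have pq: "300 * q \<le> p" .
  obtain t where t: "Q_pq p q t = 0"
    "p^2 + 2*p*q - 2*q^2 + 5*q^3/p - 20*q^4/p^2 < t"
    "t < p^2 + 2*p*q - 2*q^2 + 5*q^3/p - 20*q^4/p^2 + 80*q^5/p^3"
    using Q_pq_root[of q p] pq q by auto
  define d where "d = x/q^3 / (B * r) * (5 - 20/q^2 * (1/r + 1/B))"
  have u: "x/q^3 = B - r" by (simp add: r_def)
  have "d = 5/r - 20/(q^2*r^2) - (5/B - 20/(B^2*q^2))"
    unfolding d_def u using r B q by (simp add: field_simps power2_eq_square)
  moreover have "F1 B x q = p^2 + 2*p*q - 2*q^2 + (5/B - 20/(B^2*q^2))"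
    unfolding F1_def p_def by (simp add: algebra_simps power2_eq_square eval_nat_numeral)
  moreover have "5*q^3/p = 5/r" "20*q^4/p^2 = 20/(q^2*r^2)" "80*q^5/p^3 = 80/(q^4*r^3)"
    unfolding pr using q r by (simp_all add: field_simps eval_nat_numeral)
  ultimately have "F1 B x q + d < t" "t < F1 B x q + d + 80 / (q^4 * r^3)"
    using t by linarith+
  then show ?thesis
    using that[of t d] t(1) by (simp add: Q_tilde_def p_def r_def d_def)
qed

text \<open>The shift \<open>d\<close> has the sign of \<open>x\<close>, while the error term is
  always positive. For \<open>x < 0\<close> the error must not carry the root past
  \<open>F1\<close>; for \<open>x > 0\<close> the two add up and must stay below
  \<open>10*x/(B^2*q^3)\<close>.\<close>

lemma Q_tilde_root_near_F1:
  fixes B x q :: real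
  assumes B: "1 \<le> B" and q: "20 \<le> q" and x: "8000 * \<bar>x\<bar> \<le> q^3" "1 \<le> \<bar>x\<bar>"
  obtains t where "Q_tilde B x q t = 0"
    "x < 0 \<Longrightarrow> F1 B x q + 10*x/(B^2*q^3) < t \<and> t < F1 B x q"
    "x > 0 \<Longrightarrow> F1 B x q < t \<and> t < F1 B x q + 10*x/(B^2*q^3)"
proof -
  define u where "u = x/q^3"
  define r where "r = B - u"
  define k where "k = 5 - 20/q^2 * (1/r + 1/B)"
  define w where "w = u / (B * r)"
  obtain t d where t: "Q_tilde B x q t = 0"
    "F1 B x q + d < t" "t < F1 B x q + d + 80 / (q^4 * r^3)" and d: "d = w * k"
    using Q_tilde_root[OF B q x(1)] unfolding u_def r_def k_def w_def by metis
  have u: "\<bar>u\<bar> \<le> 1/8000" using q x by (simp add: u_def field_simps)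
  then have r: "r \<ge> 7999/8000" using B unfolding r_def by linarith
  \<comment> \<open>The subtracted part of \<open>k\<close> is positive and at most
    \<open>1/20 * 4 = 0.2\<close>.\<close>
  have k: "4.8 \<le> k" "k < 5"
  proof -
    have "20 * 20 \<le> q * q" using q by (intro mult_mono) auto
    then have q2: "20/q^2 \<le> 1/20" using q by (simp add: field_simps power2_eq_square)
    have "1/r \<le> 2" "1/B \<le> 2" using r B by (simp_all add: field_simps)
    then have "1/r + 1/B \<le> 4" by linarith
    then have "20/q^2 * (1/r + 1/B) \<le> 1/20 * 4"
      using q2 r B by (intro mult_mono) auto
    moreover have "20/q^2 * (1/r + 1/B) > 0" using r B q by (intro mult_pos_pos add_pos_pos) auto
    ultimately show "4.8 \<le> k" "k < 5" unfolding k_def by simp_all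
  qed
  have e: "80 / (q^4 * r^3) \<le> 4 * \<bar>u\<bar> / r^3"
  proof -
    have "80 * 1 \<le> 4 * q * \<bar>x\<bar>" using q x by (intro mult_mono) auto
    then show ?thesis
      using q r by (simp add: u_def field_simps eval_nat_numeral)
  qed
  have X: "10*x/(B^2*q^3) = 10*u/B^2" by (simp add: u_def)
  show ?thesis
  proof (rule that[OF t(1)])
    assume "x < 0"
    then have u0: "u < 0" using q by (simp add: u_def divide_less_0_iff)
    then have rB: "B < r" by (simp add: r_def)
    have w0: "w < 0" using u0 B r by (simp add: w_def divide_less_0_iff)
    have "1 / (B * r) < 2 / B^2"
      using rB B by (simp add: field_simps power2_eq_square)
    from mult_strict_left_mono_neg[OF this u0] have "2*u/B^2 < w"
      by (simp add: w_def mult.commute)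
    moreover have "w * k \<ge> w * 5" using w0 k by (intro mult_left_mono_neg) auto
    ultimately have "10*u/B^2 < d" unfolding d by simp
    \<comment> \<open>The error is at most \<open>4 * |w|\<close>, whereas \<open>d\<close> lies at
      least \<open>4.8 * |w|\<close> below zero.\<close>
    moreover have "4 * \<bar>u\<bar> / r^3 \<le> - 4 * w"
    proof -
      have "B * 1 \<le> r * r" using rB B by (intro mult_mono) auto
      then have "1 / r^3 \<le> 1 / (B * r)"
        using rB B by (simp add: field_simps power3_eq_cube)
      from mult_left_mono_neg[OF this, of "4 * u"] show ?thesis
        using u0 by (simp add: w_def)
    qed
    moreover have "w * k \<le> w * 4.8" using w0 k by (intro mult_left_mono_neg) auto
    ultimately show "F1 B x q + 10*x/(B^2*q^3) < t \<and> t < F1 B x q"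
      using t e w0 unfolding X d by linarith
  next
    assume "x > 0"
    then have u0: "u > 0" using q by (simp add: u_def)
    then have rB: "r < B" by (simp add: r_def)
    have w0: "w > 0" using u0 B r by (simp add: w_def)
    have "w * k \<le> w * 5" using w0 k by (intro mult_left_mono) auto
    moreover have "0 < w * k" using w0 k by simp
    \<comment> \<open>As \<open>r\<close> differs from \<open>B\<close> by at most
      \<open>1/8000\<close>, replacing \<open>r\<close> by \<open>B\<close> costs factors of at most
      1.01 and 1.1, and \<open>5 * 1.01 + 4 * 1.1 = 9.45\<close> is below 10.\<close>
    moreover have "w * 5 + 4 * \<bar>u\<bar> / r^3 < 10*u/B^2"
    proof -
      have Br: "B \<le> 1.01 * r" using u r unfolding r_def by (simp add: abs_le_iff)
      then have "1 / (B * r) \<le> 1.01 / B^2"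
        using B r by (simp add: field_simps power2_eq_square)
      from mult_left_mono[OF this, of "5 * u"] have 1: "w * 5 \<le> 5.05 * u / B^2"
        using u0 by (simp add: w_def mult.commute)
      have "B * B \<le> (1.01 * r) * (1.01 * r)"
        using Br B by (intro mult_mono) auto
      also have "\<dots> \<le> 1.1 * r * (r * r)"
        using mult_right_mono[of "1.01 * 1.01" "1.1 * r" "r * r"] r by simp
      finally have "1 / r^3 \<le> 1.1 / B^2"
        using B r by (simp add: field_simps power2_eq_square power3_eq_cube)
      from mult_left_mono[OF this, of "4 * u"] have 2: "4 * \<bar>u\<bar> / r^3 \<le> 4.4 * u / B^2"
        using u0 by simp
      have "5.05 * u / B^2 + 4.4 * u / B^2 = 9.45 * (u / B^2)" by simp
      also have "\<dots> < 10 * (u / B^2)" using u0 B by (intro mult_strict_right_mono) auto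
      finally show ?thesis using 1 2 by simp
    qed
    ultimately show "F1 B x q < t \<and> t < F1 B x q + 10*x/(B^2*q^3)"
      using t e unfolding X d by linarith
  qed
qed

theorem theorem4p1:
  fixes B pt qt :: int
  assumes "B \<in> {1..9}"
    and "pt \<noteq> 0"
    and "qt > 0"
    and "real_of_int qt \<ge> 20 * root 3 \<bar>real_of_int pt\<bar>"
  shows "(pt < 0 \<longrightarrow>
            (\<exists>t::real. Q_tilde (real_of_int B) (real_of_int pt) (real_of_int qt) t = 0 \<and>
               F1 (real_of_int B) (real_of_int pt) (real_of_int qt)
                 + 10 * real_of_int pt / ((real_of_int B)^2 * (real_of_int qt)^3) < t \<and>
               t < F1 (real_of_int B) (real_of_int pt) (real_of_int qt))) \<and>
         (pt > 0 \<longrightarrow>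
            (\<exists>t::real. Q_tilde (real_of_int B) (real_of_int pt) (real_of_int qt) t = 0 \<and>
               F1 (real_of_int B) (real_of_int pt) (real_of_int qt) < t \<and>
               t < F1 (real_of_int B) (real_of_int pt) (real_of_int qt)
                 + 10 * real_of_int pt / ((real_of_int B)^2 * (real_of_int qt)^3)))"
proof -
  define b x q where "b = real_of_int B" and "x = real_of_int pt" and "q = real_of_int qt"
  have b: "1 \<le> b" using assms(1) by (simp add: b_def)
  \<comment> \<open>Integrality of \<open>pt\<close> enters here; it yields
    \<open>20 \<le> q\<close> below and the error bound in
    \<open>Q_tilde_root_near_F1\<close>.\<close>
  have x: "1 \<le> \<bar>x\<bar>" using assms(2) by (simp add: x_def flip: of_int_abs)
  have rq: "20 * root 3 \<bar>x\<bar> \<le> q" using assms(4) by (simp add: x_def q_def)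
  have "1 \<le> root 3 \<bar>x\<bar>" using x by simp
  then have q: "20 \<le> q" using rq by linarith
  have "(20 * root 3 \<bar>x\<bar>)^3 \<le> q^3" using rq by (intro power_mono) auto
  then have "8000 * \<bar>x\<bar> \<le> q^3" by (simp add: power_mult_distrib)
  then obtain t where "Q_tilde b x q t = 0"
    "x < 0 \<Longrightarrow> F1 b x q + 10*x/(b^2*q^3) < t \<and> t < F1 b x q"
    "x > 0 \<Longrightarrow> F1 b x q < t \<and> t < F1 b x q + 10*x/(b^2*q^3)"
    using Q_tilde_root_near_F1[OF b q _ x] by blast
  then show ?thesis
    unfolding b_def x_def q_def by auto
qed

end
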